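(* For every three-qubit density matrix $\rho$ on $(\mathbb{C}^2)^{\otimes 3}$, $E_G(\rho)\le E_G(|\mathrm{W}\rangle\langle \mathrm{W}|)=\frac59$, where $|\mathrm{W}\rangle=\frac{1}{\sqrt3}(|100\rangle+|010\rangle+|001\rangle)$. That is, the W state is a maximally entangled state among all (pure or mixed) three-qubit states with respect to the geometric measure.
   Context: For a normalized pure state $|\psi\rangle$ of an $n$-partite system, $G(|\psi\rangle):=\max |\langle a_1|\cdots\langle a_n|\,\psi\rangle|$ over all normalized single-party states $|a_1\rangle,\dots,|a_n\rangle$, and $E_G(|\psi\rangle):=1-G(|\psi\rangle)^2$. For a mixed state $\rho$, $E_G(\rho):=\min\sum_i p_i E_G(|\psi_i\rangle)$, the minimum taken over all decompositions $\rho=\sum_i p_i|\psi_i\rangle\langle\psi_i|$ with $p_i\ge0$, $\sum_ip_i=1$ and normalized pure states $|\psi_i\rangle$ (convex roof). *)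

theory Defs
  imports "HOL-Analysis.Analysis"
begin

text \<open>Computational basis of three qubits: index (i1,i2,i3) stands for |i1 i2 i3>,
  with False = 0 and True = 1. Vectors/matrices are complex functions on the basis.\<close>

type_synonym qubit = "bool \<Rightarrow> complex"
type_synonym state3 = "bool \<times> bool \<times> bool \<Rightarrow> complex"
type_synonym mat3 = "bool \<times> bool \<times> bool \<Rightarrow> bool \<times> bool \<times> bool \<Rightarrow> complex"

definition normalized :: "('i::finite \<Rightarrow> complex) \<Rightarrow> bool" where
  "normalized v \<longleftrightarrow> (\<Sum>x\<in>UNIV. (cmod (v x))\<^sup>2) = 1"

definition braket :: "('i::finite \<Rightarrow> complex) \<Rightarrow> ('i \<Rightarrow> complex) \<Rightarrow> complex" where
  "braket u v = (\<Sum>x\<in>UNIV. cnj (u x) * v x)"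

definition prod_state :: "qubit \<Rightarrow> qubit \<Rightarrow> qubit \<Rightarrow> state3" where
  "prod_state a1 a2 a3 = (\<lambda>(i,j,k). a1 i * a2 j * a3 k)"

definition G_pure :: "state3 \<Rightarrow> real" where
  "G_pure \<psi> = Sup {cmod (braket (prod_state a1 a2 a3) \<psi>) | a1 a2 a3.
       normalized a1 \<and> normalized a2 \<and> normalized a3}"

definition EG_pure :: "state3 \<Rightarrow> real" where
  "EG_pure \<psi> = 1 - (G_pure \<psi>)\<^sup>2"

definition projector :: "state3 \<Rightarrow> mat3" where
  "projector \<psi> = (\<lambda>x y. \<psi> x * cnj (\<psi> y))"

definition density_matrix :: "mat3 \<Rightarrow> bool" where
  "density_matrix \<rho> \<longleftrightarrow>
     (\<forall>x y. \<rho> y x = cnj (\<rho> x y)) \<and>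
     (\<forall>v::state3. 0 \<le> Re (\<Sum>x\<in>UNIV. \<Sum>y\<in>UNIV. cnj (v x) * \<rho> x y * v y)) \<and>
     (\<Sum>x\<in>UNIV. \<rho> x x) = 1"

definition decomposition :: "mat3 \<Rightarrow> (real \<times> state3) list \<Rightarrow> bool" where
  "decomposition \<rho> D \<longleftrightarrow>
     (\<forall>(p,\<psi>)\<in>set D. 0 \<le> p \<and> normalized \<psi>) \<and>
     (\<Sum>(p,\<psi>)\<leftarrow>D. p) = 1 \<and>
     \<rho> = (\<lambda>x y. \<Sum>(p,\<psi>)\<leftarrow>D. complex_of_real p * projector \<psi> x y)"

definition EG :: "mat3 \<Rightarrow> real" where
  "EG \<rho> = Inf {(\<Sum>(p,\<psi>)\<leftarrow>D. p * EG_pure \<psi>) | D. decomposition \<rho> D}"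

definition W_state :: state3 where
  "W_state = (\<lambda>x. if x = (True,False,False) \<or> x = (False,True,False) \<or> x = (False,False,True)
                  then complex_of_real (1 / sqrt 3) else 0)"

end

theory Submission
  imports Defs
begin

text \<open>Every normalized three-qubit vector has overlap at least 2/3 with some product state. Take a
  product state of maximal overlap \<open>g\<close> and extend its factors to orthonormal bases. Maximality kills the
  coefficients with a single excitation, so the vector is \<open>g\<close> times
  \<open>|000> + t1 |011> + t2 |101> + t3 |110> + h |111>\<close>. Contracting the first party with \<open>(1, y)\<close>
  leaves a 2x2 matrix of operator norm at most \<open>sqrt (1 + |y|^2)\<close>; for \<open>y = r e\<close> with \<open>|e| = 1\<close> the
  resulting determinant inequality is quadratic in \<open>r\<close>. With \<open>T = |t1|^2 + |t2|^2 + |t3|^2\<close> and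
  \<open>p = |t1 t2 t3|\<close>, its constant term gives \<open>T + 2 p \<le> 1\<close>, hence \<open>p \<le> 1/8\<close>, and its discriminant
  gives \<open>|h|^2 \<le> 1 - T + 2 p\<close>. So the squared norm is at most \<open>g^2 (2 + 2 p) \<le> (9/4) g^2\<close>.
  For mixed states it then suffices that a decomposition exists (Cholesky), and for W that every
  decomposition of a pure projector consists of phase multiples of the same vector.\<close>

section \<open>Tensors in normal form\<close>

text \<open>The point \<open>x = 0\<close> is excluded because the quadratics of
  \<open>slice_quadratic\<close> appear only after division by \<open>r\<^sup>2\<close>; continuity
  restores it. The discriminant bound for \<open>d \<noteq> 0\<close> is then the value at the
  vertex \<open>b / d\<close>.\<close>

lemma quadratic_nonneg_discriminant:
  fixes a b d :: real
  assumes "\<And>x. x \<noteq> 0 \<Longrightarrow> 0 \<le> a - 2 * b * x + d * x\<^sup>2"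
  shows "0 \<le> a" "0 \<le> d" "b\<^sup>2 \<le> a * d"
proof -
  have all: "0 \<le> a - 2 * b * x + d * x\<^sup>2" for x
  proof (cases "x = 0")
    case True
    have "((\<lambda>x. a - 2 * b * x + d * x\<^sup>2) \<longlongrightarrow> a - 2 * b * 0 + d * 0\<^sup>2) (at 0)"
      by (intro tendsto_intros)
    then have "0 \<le> a - 2 * b * 0 + d * 0\<^sup>2"
      by (rule tendsto_lowerbound) (auto simp: eventually_at_filter assms)
    then show ?thesis using True by simp
  qed (use assms in auto)
  show a: "0 \<le> a" using all[of 0] by simp
  show d: "0 \<le> d"
  proof (rule ccontr)
    assume "\<not> 0 \<le> d"
    \<comment> \<open>If \<open>d < 0\<close>, this point is at least 1 and large enough that
      \<open>- d * x\<close> exceeds \<open>a + 2 * \<bar>b\<bar>\<close>, so the quadratic term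
      beats the other two.\<close>
    define x where "x = (a + 2 * \<bar>b\<bar> + 1) / (- d) + 1"
    have x1: "x \<ge> 1" unfolding x_def using \<open>\<not> 0 \<le> d\<close> a by (simp add: divide_nonneg_neg)
    have "- d * x > a + 2 * \<bar>b\<bar>"
      unfolding x_def using \<open>\<not> 0 \<le> d\<close> by (simp add: field_simps)
    then have "(- d * x) * x > (a + 2 * \<bar>b\<bar>) * x" using x1 by (intro mult_strict_right_mono) auto
    moreover have "a \<le> a * x" using a x1 by (simp add: mult_le_cancel_left1)
    moreover have "- (b * x) \<le> \<bar>b\<bar> * x" using x1 mult_right_mono[of "- b" "\<bar>b\<bar>" x] by auto
    ultimately show False using all[of x] by (simp add: algebra_simps power2_eq_square)
  qed
  show "b\<^sup>2 \<le> a * d"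
  proof (cases "d = 0")
    case False
    then have "0 \<le> (a - 2 * b * (b / d) + d * (b / d)\<^sup>2) * d" by (intro mult_nonneg_nonneg all d)
    also have "\<dots> = a * d - b\<^sup>2" using False by (simp add: field_simps power2_eq_square)
    finally show ?thesis by simp
  next
    case True
    have "b = 0"
    proof (rule ccontr)
      assume "b \<noteq> 0"
      then have "2 * b * ((a + 1) / b) = 2 * (a + 1)" by simp
      then show False using all[of "(a + 1) / b"] a unfolding True by simp
    qed
    then show ?thesis using True by simp
  qed
qed

lemma cmod_add_power2: "(cmod (x + y))\<^sup>2 = (cmod x)\<^sup>2 + (cmod y)\<^sup>2 + 2 * Re (cnj x * y)"
  unfolding cmod_power2 by (simp add: power2_eq_square algebra_simps)

lemma unit_phase_ex: "\<exists>e. cmod e = 1 \<and> e * z = of_real (cmod z)"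
proof (cases "z = 0")
  case False
  then have "cmod (cnj z / of_real (cmod z)) = 1" by (simp add: norm_divide)
  moreover have "cnj z / of_real (cmod z) * z = of_real (cmod z)"
    using False by (simp add: field_simps complex_norm_square[symmetric] power2_eq_square)
  ultimately show ?thesis by blast
qed (auto intro: exI[of _ 1])

text \<open>For the matrix M with rows (\<alpha>, \<beta>) and (\<gamma>, \<delta>), the assumption
  says that K I - M* M is positive semidefinite. The conclusion is that its determinant, K^2 - K
  tr(M* M) + |det M|^2, is nonnegative.\<close>

lemma bounded_2x2_det:
  fixes \<alpha> \<beta> \<gamma> \<delta> :: complex
  assumes "\<And>x y. (cmod (\<alpha> * x + \<beta> * y))\<^sup>2 + (cmod (\<gamma> * x + \<delta> * y))\<^sup>2 \<le> K * ((cmod x)\<^sup>2 + (cmod y)\<^sup>2)"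
  shows "K * ((cmod \<alpha>)\<^sup>2 + (cmod \<beta>)\<^sup>2 + (cmod \<gamma>)\<^sup>2 + (cmod \<delta>)\<^sup>2) \<le> K\<^sup>2 + (cmod (\<alpha> * \<delta> - \<beta> * \<gamma>))\<^sup>2"
proof -
  define A where "A = K - (cmod \<alpha>)\<^sup>2 - (cmod \<gamma>)\<^sup>2"
  define B where "B = K - (cmod \<beta>)\<^sup>2 - (cmod \<delta>)\<^sup>2"
  define \<Gamma> where "\<Gamma> = cnj \<alpha> * \<beta> + cnj \<gamma> * \<delta>"
  obtain e where e: "cmod e = 1" "e * \<Gamma> = of_real (cmod \<Gamma>)" using unit_phase_ex by blast
  have "0 \<le> A - 2 * cmod \<Gamma> * r + B * r\<^sup>2" for r :: real
  proof -
    have "(cmod (\<alpha> + \<beta> * (of_real r * e)))\<^sup>2 + (cmod (\<gamma> + \<delta> * (of_real r * e)))\<^sup>2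
        = (cmod \<alpha>)\<^sup>2 + (cmod \<gamma>)\<^sup>2 + ((cmod \<beta>)\<^sup>2 + (cmod \<delta>)\<^sup>2) * r\<^sup>2 + 2 * Re (r * (e * \<Gamma>))"
      unfolding cmod_add_power2 \<Gamma>_def
      by (simp add: norm_mult power_mult_distrib e(1) algebra_simps)
    also have "Re (r * (e * \<Gamma>)) = r * cmod \<Gamma>" unfolding e(2) by simp
    finally show ?thesis
      using assms[of 1 "of_real r * e"] by (simp add: A_def B_def norm_mult power_mult_distrib e(1) algebra_simps)
  qed
  then have "(cmod \<Gamma>)\<^sup>2 \<le> A * B" by (rule quadratic_nonneg_discriminant)
  \<comment> \<open>This is det(M* M) = |det M|^2, with \<open>\<Gamma>\<close> the off-diagonal
    entry of M* M.\<close>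
  moreover have "(cmod \<Gamma>)\<^sup>2 = ((cmod \<alpha>)\<^sup>2 + (cmod \<gamma>)\<^sup>2) * ((cmod \<beta>)\<^sup>2 + (cmod \<delta>)\<^sup>2) - (cmod (\<alpha> * \<delta> - \<beta> * \<gamma>))\<^sup>2"
    unfolding \<Gamma>_def cmod_power2 by (simp add: power2_eq_square algebra_simps)
  ultimately show ?thesis by (simp add: A_def B_def algebra_simps power2_eq_square)
qed

lemma amgm_cubed:
  fixes x y z :: real
  assumes "0 \<le> x" "0 \<le> y" "0 \<le> z"
  shows "27 * (x * y * z) \<le> (x + y + z) ^ 3"
proof -
  \<comment> \<open>The first summand is x^3 + y^3 + z^3 - 3xyz in factored form; the second
    collects the mixed terms of the cube minus 18xyz.\<close>
  have "0 \<le> (x + y + z) * ((x - y)\<^sup>2 + (y - z)\<^sup>2 + (z - x)\<^sup>2) / 2 + 3 * (x * (y - z)\<^sup>2 + y * (z - x)\<^sup>2 + z * (x - y)\<^sup>2)"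
    using assms by (intro add_nonneg_nonneg mult_nonneg_nonneg divide_nonneg_pos) auto
  also have "\<dots> = (x + y + z) ^ 3 - 27 * (x * y * z)"
    by (simp add: power3_eq_cube power2_eq_square field_simps)
  finally show ?thesis by simp
qed

text \<open>Here \<open>x\<close>, \<open>y\<close>, \<open>z\<close> stand for |t1|, |t2|, |t3| and
  \<open>k\<close> for |h|^2. The hypotheses \<open>D\<close>, \<open>H\<close>, \<open>Z\<close>
  come from the leading coefficient, the constant term and the discriminant of the slice quadratic.
  Once \<open>k \<le> b\<close> is known, the sum is at most 1 + 2xyz.\<close>

lemma norm_bound_of_constraints:
  fixes x y z k :: real
  assumes nn: "0 \<le> x" "0 \<le> y" "0 \<le> z" "0 \<le> k"
    and D: "k \<le> (1 - y\<^sup>2) * (1 - z\<^sup>2)"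
    and H: "x\<^sup>2 + y\<^sup>2 + z\<^sup>2 + 2 * (x * y * z) \<le> 1"
    and Z: "k * (x - y * z)\<^sup>2 \<le> (1 - (x\<^sup>2 + y\<^sup>2 + z\<^sup>2) + 2 * (x * y * z)) * ((1 - y\<^sup>2) * (1 - z\<^sup>2) - k)"
  shows "x\<^sup>2 + y\<^sup>2 + z\<^sup>2 + k \<le> 5 / 4"
proof -
  define Q where "Q = (1 - y\<^sup>2) * (1 - z\<^sup>2)"
  define b where "b = 1 - (x\<^sup>2 + y\<^sup>2 + z\<^sup>2) + 2 * (x * y * z)"
  have p0: "0 \<le> x * y * z" using nn by simp
  have b0: "0 \<le> b" using H p0 unfolding b_def by linarith
  have "Q - b = (x - y * z)\<^sup>2" unfolding Q_def b_def by (simp add: power2_eq_square algebra_simps)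
  \<comment> \<open>The two occurrences of \<open>k * b\<close> cancel, which leaves \<open>k \<le> b\<close>.\<close>
  then have "k * (Q - b) \<le> b * (Q - k)" using Z unfolding Q_def b_def by simp
  then have "k * Q \<le> b * Q" by (simp add: algebra_simps)
  moreover have "k \<le> Q" using D Q_def by simp
  ultimately have kb: "k \<le> b" using nn b0 by (cases "Q = 0") auto
  \<comment> \<open>If xyz exceeded 1/8, AM-GM on the squares would push their sum above 3/4,
    against \<open>H\<close>.\<close>
  have p8: "x * y * z \<le> 1 / 8"
  proof (rule ccontr)
    assume n: "\<not> x * y * z \<le> 1 / 8"
    then have "(1/8)\<^sup>2 < (x * y * z)\<^sup>2" by (intro power_strict_mono) auto
    then have "27 / 64 < 27 * (x\<^sup>2 * y\<^sup>2 * z\<^sup>2)" by (simp add: power_mult_distrib power_divide)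
    also have "\<dots> \<le> (x\<^sup>2 + y\<^sup>2 + z\<^sup>2) ^ 3" by (rule amgm_cubed) auto
    finally have "(3 / 4) ^ 3 < (x\<^sup>2 + y\<^sup>2 + z\<^sup>2) ^ 3" by (simp add: power3_eq_cube)
    then have "3 / 4 < x\<^sup>2 + y\<^sup>2 + z\<^sup>2" by (rule power_less_imp_less_base) simp
    then show False using H n by linarith
  qed
  show ?thesis using kb p8 unfolding b_def by linarith
qed

text \<open>The matrix with rows (1, y t2) and (y t3, t1 + h y) satisfies
  \<open>bounded_2x2_det\<close> with K = 1 + |y|^2. At y = r e the terms free of r cancel and
  everything left is divisible by r^2; the quotient is a quadratic in r.\<close>

lemma slice_quadratic:
  fixes t1 t2 t3 h e :: complex and r :: real
  assumes bound: "\<And>y c0 c1. (cmod (c0 + y * t2 * c1))\<^sup>2 + (cmod (y * t3 * c0 + (t1 + h * y) * c1))\<^sup>2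
        \<le> (1 + (cmod y)\<^sup>2) * ((cmod c0)\<^sup>2 + (cmod c1)\<^sup>2)"
    and e: "cmod e = 1" and r: "r \<noteq> 0"
  shows "0 \<le> (1 - ((cmod t1)\<^sup>2 + (cmod t2)\<^sup>2 + (cmod t3)\<^sup>2) - 2 * Re (cnj t1 * (e\<^sup>2 * (t2 * t3))))
      - 2 * Re (e * (cnj t1 * h + t2 * t3 * cnj h)) * r
      + ((1 - (cmod t2)\<^sup>2) * (1 - (cmod t3)\<^sup>2) - (cmod h)\<^sup>2) * r\<^sup>2" (is "0 \<le> ?q")
proof -
  define y where "y = of_real r * e"
  define K where "K = 1 + (cmod y)\<^sup>2"
  have Y: "(cmod y)\<^sup>2 = r\<^sup>2" using e by (simp add: y_def norm_mult)
  have ee: "e * cnj e = 1" using e by (metis complex_norm_square of_real_1 one_power2)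
  have "K * ((cmod 1)\<^sup>2 + (cmod (y * t2))\<^sup>2 + (cmod (y * t3))\<^sup>2 + (cmod (t1 + h * y))\<^sup>2)
      \<le> K\<^sup>2 + (cmod (1 * (t1 + h * y) - (y * t2) * (y * t3)))\<^sup>2"
    by (rule bounded_2x2_det) (use bound in \<open>simp add: K_def\<close>)
  also have "(cmod (1 * (t1 + h * y) - (y * t2) * (y * t3)))\<^sup>2
     = (cmod (t1 + h * y))\<^sup>2 + (cmod (y\<^sup>2 * (t2 * t3)))\<^sup>2 - 2 * Re (cnj (t1 + h * y) * (y\<^sup>2 * (t2 * t3)))"
    using cmod_add_power2[of "t1 + h * y" "- (y\<^sup>2 * (t2 * t3))"] by (simp add: power2_eq_square algebra_simps)
  finally have 1: "0 \<le> K\<^sup>2 - K * (1 + r\<^sup>2 * ((cmod t2)\<^sup>2 + (cmod t3)\<^sup>2)) - r\<^sup>2 * (cmod (t1 + h * y))\<^sup>2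
      + r^4 * ((cmod t2)\<^sup>2 * (cmod t3)\<^sup>2) - 2 * Re (cnj (t1 + h * y) * (y\<^sup>2 * (t2 * t3)))"
    unfolding norm_mult norm_power power_mult_distrib Y K_def
    by (simp add: algebra_simps power2_eq_square power4_eq_xxxx)
  have 2: "(cmod (t1 + h * y))\<^sup>2 = (cmod t1)\<^sup>2 + (cmod h)\<^sup>2 * r\<^sup>2 + 2 * r * Re (e * (cnj t1 * h))"
    unfolding cmod_add_power2 norm_mult power_mult_distrib Y unfolding y_def by (simp add: algebra_simps)
  have "cnj (t1 + h * y) * (y\<^sup>2 * (t2 * t3))
     = of_real (r\<^sup>2) * (cnj t1 * (e\<^sup>2 * (t2 * t3))) + of_real (r^3) * ((e * cnj e) * (e * (t2 * t3 * cnj h)))"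
    unfolding y_def by (simp add: algebra_simps power2_eq_square power3_eq_cube)
  then have 3: "Re (cnj (t1 + h * y) * (y\<^sup>2 * (t2 * t3)))
     = r\<^sup>2 * Re (cnj t1 * (e\<^sup>2 * (t2 * t3))) + r^3 * Re (e * (t2 * t3 * cnj h))"
    unfolding ee by (simp only: mult_1 plus_complex.sel times_complex.sel Re_complex_of_real Im_complex_of_real mult_zero_left diff_zero)
  have 4: "Re (e * (cnj t1 * h + t2 * t3 * cnj h)) = Re (e * (cnj t1 * h)) + Re (e * (t2 * t3 * cnj h))"
    by (simp add: distrib_left)
  have "0 \<le> r\<^sup>2 * ?q"
    using 1 unfolding 2 3 4 K_def Y
    by (simp add: algebra_simps power2_eq_square power3_eq_cube power4_eq_xxxx)
  then show ?thesis using r by (simp add: zero_le_mult_iff)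
qed

text \<open>The slice quadratic is available for every phase, and two choices are used: one makes
  the constant term as small as possible, the other makes the linear coefficient equal to |z|. Under
  the second the phase in the constant term is uncontrolled, so there it is only bounded by
  \<open>1 - T + 2 * p\<close>.\<close>

lemma normal_form_norm_bound:
  fixes t1 t2 t3 h :: complex
  assumes bound: "\<And>y c0 c1. (cmod (c0 + y * t2 * c1))\<^sup>2 + (cmod (y * t3 * c0 + (t1 + h * y) * c1))\<^sup>2
        \<le> (1 + (cmod y)\<^sup>2) * ((cmod c0)\<^sup>2 + (cmod c1)\<^sup>2)"
  shows "(cmod t1)\<^sup>2 + (cmod t2)\<^sup>2 + (cmod t3)\<^sup>2 + (cmod h)\<^sup>2 \<le> 5 / 4"
proof -
  define T where "T = (cmod t1)\<^sup>2 + (cmod t2)\<^sup>2 + (cmod t3)\<^sup>2"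
  define p where "p = cmod t1 * cmod t2 * cmod t3"
  define D where "D = (1 - (cmod t2)\<^sup>2) * (1 - (cmod t3)\<^sup>2) - (cmod h)\<^sup>2"
  define z where "z = cnj t1 * h + t2 * t3 * cnj h"
  note quad = quadratic_nonneg_discriminant[OF slice_quadratic[of t2 t3 t1 h, OF bound], folded T_def D_def z_def]
  obtain e where e: "cmod e = 1" "e * (cnj t1 * (t2 * t3)) = of_real (cmod (cnj t1 * (t2 * t3)))"
    using unit_phase_ex by blast
  \<comment> \<open>The phase enters the constant term squared, so aligning that term takes a square
    root of \<open>e\<close>.\<close>
  have ce: "cmod (csqrt e) = 1" using e(1) by simp
  have "cnj t1 * ((csqrt e)\<^sup>2 * (t2 * t3)) = of_real p"
    using e(2) by (simp add: p_def norm_mult algebra_simps)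
  then have "Re (cnj t1 * ((csqrt e)\<^sup>2 * (t2 * t3))) = p" by (simp only: Re_complex_of_real)
  with quad(1)[OF ce] have H: "T + 2 * p \<le> 1" by linarith
  obtain f where f: "cmod f = 1" "f * z = of_real (cmod z)" using unit_phase_ex by blast
  have D0: "0 \<le> D" using quad(2)[OF f(1)] .
  have "(cmod z)\<^sup>2 \<le> (1 - T - 2 * Re (cnj t1 * (f\<^sup>2 * (t2 * t3)))) * D"
    using quad(3)[OF f(1)] f(2) by simp
  also have "\<dots> \<le> (1 - T + 2 * p) * D"
  proof (intro mult_right_mono D0)
    have "- Re (cnj t1 * (f\<^sup>2 * (t2 * t3))) \<le> cmod (cnj t1 * (f\<^sup>2 * (t2 * t3)))"
      using complex_Re_le_cmod[of "- (cnj t1 * (f\<^sup>2 * (t2 * t3)))"] by simp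
    also have "\<dots> = p" using f(1) by (simp add: norm_mult norm_power p_def)
    finally show "1 - T - 2 * Re (cnj t1 * (f\<^sup>2 * (t2 * t3))) \<le> 1 - T + 2 * p" by simp
  qed
  finally have Z: "(cmod z)\<^sup>2 \<le> (1 - T + 2 * p) * D" .
  \<comment> \<open>Reverse triangle inequality: the two summands of \<open>z\<close> have moduli
    |t1||h| and |t2||t3||h|.\<close>
  have "\<bar>cmod h * (cmod t1 - cmod t2 * cmod t3)\<bar> \<le> cmod z"
    using norm_triangle_ineq3[of "cnj t1 * h" "- (t2 * t3 * cnj h)"]
    by (simp add: z_def norm_mult algebra_simps)
  then have "(cmod h * (cmod t1 - cmod t2 * cmod t3))\<^sup>2 \<le> (cmod z)\<^sup>2"
    by (meson abs_ge_zero abs_le_square_iff abs_of_nonneg norm_ge_zero order_trans power2_le_iff_abs_le)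
  then have "(cmod h)\<^sup>2 * (cmod t1 - cmod t2 * cmod t3)\<^sup>2 \<le> (1 - T + 2 * p) * D"
    using Z by (simp add: power_mult_distrib)
  then show ?thesis
    using D0 H unfolding T_def p_def D_def by (intro norm_bound_of_constraints) auto
qed

text \<open>First-order optimality: along the phase that aligns \<open>w\<close>, the difference of
  the two sides is a nonnegative quadratic with zero constant term, so its linear coefficient
  vanishes.\<close>

lemma perturbation_coeff_zero:
  fixes w :: complex
  assumes "\<And>z. (cmod (1 + z * w))\<^sup>2 \<le> 1 + (cmod z)\<^sup>2"
  shows "w = 0"
proof -
  obtain e where e: "cmod e = 1" "e * w = of_real (cmod w)" using unit_phase_ex by blast
  have "0 \<le> 0 - 2 * cmod w * r + (1 - (cmod w)\<^sup>2) * r\<^sup>2" for r :: real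
  proof -
    have "1 + of_real r * e * w = of_real (1 + r * cmod w)" using e(2) by (simp add: mult.assoc)
    then have "(cmod (1 + of_real r * e * w))\<^sup>2 = (1 + r * cmod w)\<^sup>2" by (simp only: norm_of_real power2_abs)
    with assms[of "of_real r * e"] e(1) show ?thesis
      by (simp add: norm_mult power2_eq_square algebra_simps)
  qed
  then have "(cmod w)\<^sup>2 \<le> 0 * (1 - (cmod w)\<^sup>2)" by (rule quadratic_nonneg_discriminant)
  then show ?thesis by simp
qed

section \<open>Product overlaps of pure states\<close>

lemma sum_bool3: "(\<Sum>x\<in>(UNIV::(bool \<times> bool \<times> bool) set). f x) = (\<Sum>i\<in>UNIV. \<Sum>j\<in>UNIV. \<Sum>k\<in>UNIV. f (i, j, k))"
  by (simp add: sum.cartesian_product UNIV_Times_UNIV[symmetric] del: UNIV_Times_UNIV)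

section \<open>Trilinear contraction and local changes of basis\<close>

definition sqn :: "('i::finite \<Rightarrow> complex) \<Rightarrow> real" where
  "sqn v = (\<Sum>x\<in>UNIV. (cmod (v x))\<^sup>2)"

text \<open>Without conjugation the contraction is linear in each qubit. Conjugation permutes the
  unit qubits, so the supremum of overlaps is the same.\<close>

definition tri :: "state3 \<Rightarrow> qubit \<Rightarrow> qubit \<Rightarrow> qubit \<Rightarrow> complex" where
  "tri \<psi> a b c = (\<Sum>i\<in>UNIV. \<Sum>j\<in>UNIV. \<Sum>k\<in>UNIV. a i * b j * c k * \<psi> (i, j, k))"

definition qubit_of :: "complex \<Rightarrow> complex \<Rightarrow> qubit" where
  "qubit_of x y = (\<lambda>i. if i then y else x)"

definition perp :: "qubit \<Rightarrow> qubit" where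
  "perp a = qubit_of (- cnj (a True)) (cnj (a False))"

definition frame :: "qubit \<Rightarrow> bool \<Rightarrow> qubit" where
  "frame a i = (if i then perp a else a)"

definition combine :: "qubit \<Rightarrow> qubit \<Rightarrow> qubit" where
  "combine a x = (\<lambda>i. x False * a i + x True * perp a i)"

lemma sqn_qubit: "sqn (a :: qubit) = (cmod (a False))\<^sup>2 + (cmod (a True))\<^sup>2"
  by (simp add: sqn_def UNIV_bool)

lemma sqn_nonneg: "0 \<le> sqn v"
  unfolding sqn_def by (simp add: sum_nonneg)

lemma normalized_iff_sqn: "normalized v \<longleftrightarrow> sqn v = 1"
  by (simp add: normalized_def sqn_def)

lemma sqn_combine: "sqn (combine a x) = sqn a * sqn x"
  unfolding sqn_qubit combine_def perp_def qubit_of_def cmod_power2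
  by (simp add: algebra_simps power2_eq_square)

lemma tri_combine:
  "tri \<psi> (combine a x) b c = (\<Sum>i\<in>UNIV. x i * tri \<psi> (frame a i) b c)"
  "tri \<psi> b (combine a x) c = (\<Sum>i\<in>UNIV. x i * tri \<psi> b (frame a i) c)"
  "tri \<psi> b c (combine a x) = (\<Sum>i\<in>UNIV. x i * tri \<psi> b c (frame a i))"
  unfolding tri_def combine_def frame_def UNIV_bool by (simp_all add: algebra_simps)

definition in_frames :: "state3 \<Rightarrow> qubit \<Rightarrow> qubit \<Rightarrow> qubit \<Rightarrow> state3" where
  "in_frames \<psi> a b c = (\<lambda>(i, j, k). tri \<psi> (frame a i) (frame b j) (frame c k))"

lemma tri_in_frames: "tri (in_frames \<psi> a b c) x y z = tri \<psi> (combine a x) (combine b y) (combine c z)"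
  unfolding tri_combine tri_def[of "in_frames \<psi> a b c"] unfolding in_frames_def
  by (simp add: UNIV_bool algebra_simps)

text \<open>The matrix with rows \<open>a\<close> and \<open>perp a\<close> is
  \<open>sqrt (sqn a)\<close> times a unitary.\<close>

lemma frame_parseval:
  "(\<Sum>i\<in>UNIV. (cmod (\<Sum>j\<in>UNIV. frame a i j * \<phi> j))\<^sup>2) = sqn a * (\<Sum>j\<in>UNIV. (cmod (\<phi> j))\<^sup>2)"
  unfolding UNIV_bool frame_def perp_def qubit_of_def sqn_qubit cmod_power2
  by (simp add: algebra_simps power2_eq_square)

text \<open>Parseval is applied to one party at a time, after reordering the sums so that its index
  is innermost.\<close>

lemma sqn_in_frames: "sqn (in_frames \<psi> a b c) = sqn a * sqn b * sqn c * sqn \<psi>"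
proof -
  have 1: "tri \<psi> u v w = (\<Sum>i\<in>UNIV. u i * (\<Sum>j\<in>UNIV. v j * (\<Sum>k\<in>UNIV. w k * \<psi> (i, j, k))))" for u v w
    by (simp add: tri_def sum_distrib_left mult.assoc)
  have "sqn (in_frames \<psi> a b c) = (\<Sum>j\<in>UNIV. \<Sum>k\<in>UNIV. \<Sum>i\<in>UNIV.
     (cmod (tri \<psi> (frame a i) (frame b j) (frame c k)))\<^sup>2)"
    unfolding sqn_def sum_bool3 in_frames_def
    by (subst sum.swap, rule sum.cong[OF refl], subst sum.swap, simp)
  also have "\<dots> = sqn a * (\<Sum>j\<in>UNIV. \<Sum>k\<in>UNIV. \<Sum>i\<in>UNIV.
     (cmod (\<Sum>j'\<in>UNIV. frame b j j' * (\<Sum>k'\<in>UNIV. frame c k k' * \<psi> (i, j', k'))))\<^sup>2)"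
    unfolding 1 frame_parseval by (simp flip: sum_distrib_left)
  also have "\<dots> = sqn a * (\<Sum>i\<in>UNIV. \<Sum>k\<in>UNIV. \<Sum>j\<in>UNIV.
     (cmod (\<Sum>j'\<in>UNIV. frame b j j' * (\<Sum>k'\<in>UNIV. frame c k k' * \<psi> (i, j', k'))))\<^sup>2)"
    unfolding UNIV_bool by simp
  also have "\<dots> = sqn a * (\<Sum>i\<in>UNIV. \<Sum>k\<in>UNIV. sqn b * (\<Sum>j\<in>UNIV.
     (cmod (\<Sum>k'\<in>UNIV. frame c k k' * \<psi> (i, j, k')))\<^sup>2))"
    by (simp only: frame_parseval)
  also have "\<dots> = sqn a * (sqn b * (\<Sum>i\<in>UNIV. \<Sum>j\<in>UNIV. \<Sum>k\<in>UNIV.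
     (cmod (\<Sum>k'\<in>UNIV. frame c k k' * \<psi> (i, j, k')))\<^sup>2))"
    by (simp add: UNIV_bool distrib_left)
  also have "\<dots> = sqn a * sqn b * sqn c * sqn \<psi>"
    unfolding frame_parseval sqn_def[of \<psi>] sum_bool3 by (simp add: mult.assoc flip: sum_distrib_left)
  finally show ?thesis .
qed

lemma cmod_le_sqn: "(cmod (v x))\<^sup>2 \<le> sqn v"
  unfolding sqn_def by (intro member_le_sum) auto

lemma braket_prod_state: "braket (prod_state a b c) \<psi> = tri \<psi> (cnj \<circ> a) (cnj \<circ> b) (cnj \<circ> c)"
  unfolding braket_def tri_def prod_state_def sum_bool3 by simp

lemma sqn_cnj: "sqn (cnj \<circ> a) = sqn a"
  by (simp add: sqn_def)

section \<open>The maximal product overlap\<close>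

lemma G_pure_eq_Sup_tri:
  "G_pure \<psi> = Sup {cmod (tri \<psi> a b c) | a b c. sqn a = 1 \<and> sqn b = 1 \<and> sqn c = 1}"
proof -
  have cc: "cnj \<circ> (cnj \<circ> a) = a" for a :: qubit by (simp add: fun_eq_iff)
  have "{cmod (braket (prod_state a1 a2 a3) \<psi>) | a1 a2 a3.
       normalized a1 \<and> normalized a2 \<and> normalized a3}
     = {cmod (tri \<psi> a b c) | a b c. sqn a = 1 \<and> sqn b = 1 \<and> sqn c = 1}"
    unfolding normalized_iff_sqn braket_prod_state
    by (intro equalityI subsetI; clarsimp) (metis sqn_cnj cc)+
  then show ?thesis unfolding G_pure_def by simp
qed

lemma tri_scale: "tri \<psi> (\<lambda>i. x * a i) (\<lambda>i. y * b i) (\<lambda>i. z * c i) = x * y * z * tri \<psi> a b c"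
  by (simp add: tri_def UNIV_bool algebra_simps)

lemma sqn_scale: "sqn (\<lambda>i. x * a i) = (cmod x)\<^sup>2 * sqn a"
  by (simp add: sqn_def norm_mult power_mult_distrib sum_distrib_left)

lemma sqn_eq_0_iff: "sqn v = 0 \<longleftrightarrow> v = (\<lambda>_. 0)"
  by (auto simp: sqn_def sum_nonneg_eq_0_iff)

lemma normalize_ex:
  assumes "v \<noteq> (\<lambda>_. 0)"
  obtains u where "sqn u = 1" "v = (\<lambda>i. of_real (sqrt (sqn v)) * u i)"
proof
  have p: "sqn v > 0" using assms sqn_nonneg[of v] sqn_eq_0_iff[of v] by linarith
  show "sqn (\<lambda>i. of_real (1 / sqrt (sqn v)) * v i) = 1"
    unfolding sqn_scale using p by (simp add: norm_divide power_divide)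
  show "v = (\<lambda>i. of_real (sqrt (sqn v)) * (of_real (1 / sqrt (sqn v)) * v i))"
    using p by (simp add: fun_eq_iff mult.assoc[symmetric] flip: of_real_mult)
qed

lemma tri_le_homogeneous:
  assumes "\<And>a b c. sqn a = 1 \<Longrightarrow> sqn b = 1 \<Longrightarrow> sqn c = 1 \<Longrightarrow> cmod (tri \<psi> a b c) \<le> g"
  shows "(cmod (tri \<psi> a b c))\<^sup>2 \<le> g\<^sup>2 * (sqn a * sqn b * sqn c)"
proof (cases "a = (\<lambda>_. 0) \<or> b = (\<lambda>_. 0) \<or> c = (\<lambda>_. 0)")
  case True
  then have "tri \<psi> a b c = 0" by (auto simp: tri_def)
  then show ?thesis by (simp add: sqn_nonneg)
next
  case False
  obtain a' where a': "sqn a' = 1" "a = (\<lambda>i. of_real (sqrt (sqn a)) * a' i)" using False normalize_ex by blast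
  obtain b' where b': "sqn b' = 1" "b = (\<lambda>i. of_real (sqrt (sqn b)) * b' i)" using False normalize_ex by blast
  obtain c' where c': "sqn c' = 1" "c = (\<lambda>i. of_real (sqrt (sqn c)) * c' i)" using False normalize_ex by blast
  have "tri \<psi> a b c = of_real (sqrt (sqn a)) * of_real (sqrt (sqn b)) * of_real (sqrt (sqn c)) * tri \<psi> a' b' c'"
    by (subst a'(2), subst b'(2), subst c'(2), rule tri_scale)
  then have "(cmod (tri \<psi> a b c))\<^sup>2 = (sqn a * sqn b * sqn c) * (cmod (tri \<psi> a' b' c'))\<^sup>2"
    by (simp add: norm_mult power_mult_distrib sqn_nonneg)
  also have "\<dots> \<le> (sqn a * sqn b * sqn c) * g\<^sup>2"
    using assms[OF a'(1) b'(1) c'(1)] by (intro mult_left_mono power_mono) (auto simp: sqn_nonneg)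
  finally show ?thesis by (simp add: mult.commute)
qed

text \<open>A continuous function attains its maximum on a compact set: qubits are encoded as pairs,
  so the domain is a product of three unit spheres.\<close>

lemma tri_maximizer_ex:
  obtains a b c where "sqn a = 1" "sqn b = 1" "sqn c = 1"
    "\<And>a' b' c'. sqn a' = 1 \<Longrightarrow> sqn b' = 1 \<Longrightarrow> sqn c' = 1 \<Longrightarrow> cmod (tri \<psi> a' b' c') \<le> cmod (tri \<psi> a b c)"
proof -
  define q :: "complex \<times> complex \<Rightarrow> qubit" where "q = (\<lambda>z. qubit_of (fst z) (snd z))"
  let ?S = "sphere (0 :: complex \<times> complex) 1"
  have S: "z \<in> ?S \<longleftrightarrow> sqn (q z) = 1" for z
    by (cases z) (simp add: sqn_qubit q_def qubit_of_def norm_Pair)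
  have q: "q (a False, a True) = a" for a by (auto simp: q_def qubit_of_def)
  define F where "F = (\<lambda>(x, y, z). cmod (tri \<psi> (q x) (q y) (q z)))"
  have "continuous_on (?S \<times> ?S \<times> ?S) F"
    unfolding F_def tri_def q_def qubit_of_def UNIV_bool case_prod_unfold
    by simp (intro continuous_intros)
  moreover have "compact (?S \<times> ?S \<times> ?S)" by (intro compact_Times compact_sphere)
  moreover have "(1, 0) \<in> ?S" by (simp add: norm_Pair)
  then have "?S \<times> ?S \<times> ?S \<noteq> {}" by blast
  ultimately obtain m where m: "m \<in> ?S \<times> ?S \<times> ?S" "\<And>n. n \<in> ?S \<times> ?S \<times> ?S \<Longrightarrow> F n \<le> F m"
    using continuous_attains_sup[of "?S \<times> ?S \<times> ?S" F] by blast
  obtain x y z where xyz: "m = (x, y, z)" by (cases m)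
  show thesis
  proof (rule that)
    show "sqn (q x) = 1" "sqn (q y) = 1" "sqn (q z) = 1" using m(1) unfolding xyz by (auto simp flip: S)
    show "cmod (tri \<psi> a' b' c') \<le> cmod (tri \<psi> (q x) (q y) (q z))"
      if "sqn a' = 1" "sqn b' = 1" "sqn c' = 1" for a' b' c'
    proof -
      have "((a' False, a' True), (b' False, b' True), (c' False, c' True)) \<in> ?S \<times> ?S \<times> ?S"
        unfolding mem_Times_iff fst_conv snd_conv S q using that by simp
      from m(2)[OF this] show ?thesis unfolding xyz F_def by (simp add: q)
    qed
  qed
qed

lemma norm_le_maximal_overlap:
  assumes unit: "sqn a = 1" "sqn b = 1" "sqn c = 1"
    and max: "\<And>a' b' c'. sqn a' = 1 \<Longrightarrow> sqn b' = 1 \<Longrightarrow> sqn c' = 1 \<Longrightarrow> cmod (tri \<psi> a' b' c') \<le> cmod (tri \<psi> a b c)"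
  shows "4 * sqn \<psi> \<le> 9 * (cmod (tri \<psi> a b c))\<^sup>2"
proof -
  define \<phi> where "\<phi> = in_frames \<psi> a b c"
  define g where "g = tri \<psi> a b c"
  have sq: "sqn \<phi> = sqn \<psi>" unfolding \<phi>_def sqn_in_frames unit by simp
  have bound: "(cmod (tri \<phi> x y z))\<^sup>2 \<le> (cmod g)\<^sup>2 * (sqn x * sqn y * sqn z)" for x y z
  proof -
    have "(cmod (tri \<psi> (combine a x) (combine b y) (combine c z)))\<^sup>2
        \<le> (cmod g)\<^sup>2 * (sqn (combine a x) * sqn (combine b y) * sqn (combine c z))"
      unfolding g_def by (rule tri_le_homogeneous) (rule max)
    then show ?thesis unfolding \<phi>_def tri_in_frames sqn_combine unit by simp
  qed
  have g: "\<phi> (False, False, False) = g" by (simp add: \<phi>_def in_frames_def frame_def g_def)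
  show ?thesis
  proof (cases "g = 0")
    case True
    \<comment> \<open>A vanishing maximal overlap forces every coefficient to vanish, since each is
      an overlap with basis vectors.\<close>
    have "(cmod (\<phi> (i, j, k)))\<^sup>2 \<le> 0" for i j k
    proof -
      have "tri \<phi> (qubit_of (of_bool (\<not> i)) (of_bool i)) (qubit_of (of_bool (\<not> j)) (of_bool j)) (qubit_of (of_bool (\<not> k)) (of_bool k)) = \<phi> (i, j, k)"
        by (simp add: tri_def UNIV_bool qubit_of_def)
      then show ?thesis using bound True by (metis mult_zero_left norm_zero zero_power2)
    qed
    then have "sqn \<phi> = 0" by (simp add: sqn_def sum_bool3)
    then show ?thesis using sq by simp
  next
    case False
    define s where "s = (\<lambda>i j k. \<phi> (i, j, k) / g)"
    have tri_s: "tri \<phi> (qubit_of x0 x1) (qubit_of y0 y1) (qubit_of z0 z1) = g *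
      (x0*y0*z0 + x0*y0*z1 * s False False True + x0*y1*z0 * s False True False + x1*y0*z0 * s True False False
       + x0*y1*z1 * s False True True + x1*y0*z1 * s True False True + x1*y1*z0 * s True True False
       + x1*y1*z1 * s True True True)" for x0 x1 y0 y1 z0 z1
      using False g by (simp add: tri_def UNIV_bool qubit_of_def s_def field_simps)
    have bs: "(cmod (x0*y0*z0 + x0*y0*z1 * s False False True + x0*y1*z0 * s False True False + x1*y0*z0 * s True False False
       + x0*y1*z1 * s False True True + x1*y0*z1 * s True False True + x1*y1*z0 * s True True False
       + x1*y1*z1 * s True True True))\<^sup>2
       \<le> ((cmod x0)\<^sup>2 + (cmod x1)\<^sup>2) * ((cmod y0)\<^sup>2 + (cmod y1)\<^sup>2) * ((cmod z0)\<^sup>2 + (cmod z1)\<^sup>2)" for x0 x1 y0 y1 z0 z1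
      using bound[of "qubit_of x0 x1" "qubit_of y0 y1" "qubit_of z0 z1"] False
      unfolding tri_s norm_mult[of g] power_mult_distrib by (simp add: sqn_qubit qubit_of_def)
    \<comment> \<open>With two parties fixed at the maximizer and the third moved to (1, z), the
      bound \<open>bs\<close> becomes the hypothesis of
      \<open>perturbation_coeff_zero\<close>.\<close>
    have s1: "s False False True = 0"
      by (rule perturbation_coeff_zero) (use bs[of 1 1 1 _ 0 0] in simp)
    have s2: "s False True False = 0"
      by (rule perturbation_coeff_zero) (use bs[of 1 1 1 0 _ 0] in simp)
    have s3: "s True False False = 0"
      by (rule perturbation_coeff_zero) (use bs[of 1 1 1 0 0] in simp)
    have "(cmod (s False True True))\<^sup>2 + (cmod (s True False True))\<^sup>2 + (cmod (s True True False))\<^sup>2 + (cmod (s True True True))\<^sup>2 \<le> 5 / 4"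
    proof (rule normal_form_norm_bound)
      fix y c0 c1
      \<comment> \<open>\<open>(u, v)\<close> is the second party's vector left after contracting
        the first party with (1, y) and the third with (c0, c1).\<close>
      define u where "u = c0 + y * s True False True * c1"
      define v where "v = y * s True True False * c0 + (s False True True + s True True True * y) * c1"
      define R where "R = (cmod u)\<^sup>2 + (cmod v)\<^sup>2"
      \<comment> \<open>Choosing \<open>(p, q)\<close> conjugate to \<open>(u, v)\<close> turns the trilinear bound into an operator norm bound.\<close>
      have pq: "(cmod (p * u + q * v))\<^sup>2
          \<le> (1 + (cmod y)\<^sup>2) * ((cmod p)\<^sup>2 + (cmod q)\<^sup>2) * ((cmod c0)\<^sup>2 + (cmod c1)\<^sup>2)" for p q
      proof -
        have "1*p*c0 + 1*p*c1 * 0 + 1*q*c0 * 0 + y*p*c0 * 0 + 1*q*c1 * s False True True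
            + y*p*c1 * s True False True + y*q*c0 * s True True False + y*q*c1 * s True True True = p * u + q * v"
          unfolding u_def v_def by (simp add: algebra_simps)
        then show ?thesis using bs[of 1 p c0 c1 q y] unfolding s1 s2 s3 by simp
      qed
      have "cnj u * u + cnj v * v = of_real R"
        unfolding R_def by (simp only: of_real_add complex_norm_square mult.commute)
      then have "R\<^sup>2 = (cmod (cnj u * u + cnj v * v))\<^sup>2" by simp
      also have "\<dots> \<le> (1 + (cmod y)\<^sup>2) * R * ((cmod c0)\<^sup>2 + (cmod c1)\<^sup>2)"
        using pq[of "cnj u" "cnj v"] unfolding R_def by simp
      finally have "R * R \<le> R * ((1 + (cmod y)\<^sup>2) * ((cmod c0)\<^sup>2 + (cmod c1)\<^sup>2))"
        by (simp add: power2_eq_square mult_ac)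
      moreover have "0 \<le> R" by (simp add: R_def)
      ultimately have "R \<le> (1 + (cmod y)\<^sup>2) * ((cmod c0)\<^sup>2 + (cmod c1)\<^sup>2)"
        by (cases "R = 0") auto
      then show "(cmod (c0 + y * s True False True * c1))\<^sup>2
          + (cmod (y * s True True False * c0 + (s False True True + s True True True * y) * c1))\<^sup>2
          \<le> (1 + (cmod y)\<^sup>2) * ((cmod c0)\<^sup>2 + (cmod c1)\<^sup>2)"
        unfolding R_def u_def v_def .
    qed
    moreover have "sqn \<phi> = (cmod g)\<^sup>2 * (1 + (cmod (s False True True))\<^sup>2 + (cmod (s True False True))\<^sup>2 + (cmod (s True True False))\<^sup>2 + (cmod (s True True True))\<^sup>2)"
    proof -
      have e: "\<phi> (i, j, k) = g * s i j k" for i j k using False by (simp add: s_def)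
      have "s False False False = 1" using False g by (simp add: s_def)
      then show ?thesis unfolding sqn_def sum_bool3 UNIV_bool
        using s1 s2 s3 by (simp add: e norm_mult power_mult_distrib algebra_simps)
    qed
    \<comment> \<open>The factor 9/4 is 1 + 5/4, the 1 coming from the coefficient of |000>.\<close>
    ultimately have "sqn \<phi> \<le> (cmod g)\<^sup>2 * (9 / 4)"
      by (simp only:) (intro mult_left_mono, auto)
    then show ?thesis using sq g_def by simp
  qed
qed

lemma G_pure_attained:
  obtains a b c where "sqn a = 1" "sqn b = 1" "sqn c = 1" "G_pure \<psi> = cmod (tri \<psi> a b c)"
    "4 * sqn \<psi> \<le> 9 * (cmod (tri \<psi> a b c))\<^sup>2"
proof -
  obtain a b c where m: "sqn a = 1" "sqn b = 1" "sqn c = 1"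
    "\<And>a' b' c'. sqn a' = 1 \<Longrightarrow> sqn b' = 1 \<Longrightarrow> sqn c' = 1 \<Longrightarrow> cmod (tri \<psi> a' b' c') \<le> cmod (tri \<psi> a b c)"
    by (rule tri_maximizer_ex[of \<psi>]) blast
  have "G_pure \<psi> = cmod (tri \<psi> a b c)"
    unfolding G_pure_eq_Sup_tri by (rule cSup_eq_maximum) (use m in auto)
  then show thesis using that[of a b c] m norm_le_maximal_overlap[OF m] by blast
qed

text \<open>The maximal overlap is a single coefficient of the state in orthonormal local frames,
  hence at most 1. The resulting lower bound 0 later makes the convex-roof infimum bounded
  below.\<close>

lemma EG_pure_bounds:
  assumes "normalized \<psi>"
  shows "0 \<le> EG_pure \<psi>" "EG_pure \<psi> \<le> 5 / 9"
proof -
  obtain a b c where m: "sqn a = 1" "sqn b = 1" "sqn c = 1" "G_pure \<psi> = cmod (tri \<psi> a b c)"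
    "4 * sqn \<psi> \<le> 9 * (cmod (tri \<psi> a b c))\<^sup>2"
    by (rule G_pure_attained[of \<psi>])
  have "(cmod (tri \<psi> a b c))\<^sup>2 \<le> sqn (in_frames \<psi> a b c)"
    using cmod_le_sqn[of "in_frames \<psi> a b c" "(False, False, False)"] by (simp add: in_frames_def frame_def)
  then show "0 \<le> EG_pure \<psi>" "EG_pure \<psi> \<le> 5 / 9"
    using assms m by (auto simp: sqn_in_frames EG_pure_def normalized_iff_sqn)
qed

section \<open>Decompositions into pure states\<close>

definition herm_form :: "('i::finite \<Rightarrow> 'i \<Rightarrow> complex) \<Rightarrow> ('i \<Rightarrow> complex) \<Rightarrow> complex" where
  "herm_form H v = (\<Sum>x\<in>UNIV. \<Sum>y\<in>UNIV. cnj (v x) * H x y * v y)"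

definition psd :: "('i::finite \<Rightarrow> 'i \<Rightarrow> complex) \<Rightarrow> bool" where
  "psd H \<longleftrightarrow> (\<forall>x y. H y x = cnj (H x y)) \<and> (\<forall>v. 0 \<le> Re (herm_form H v))"

lemma herm_form_shift:
  fixes H :: "'i::finite \<Rightarrow> 'i \<Rightarrow> complex"
  assumes "\<And>x y. H y x = cnj (H x y)"
  shows "Re (herm_form H (\<lambda>y. v y + (if y = x then c else 0)))
    = Re (herm_form H v) + 2 * Re (cnj c * (\<Sum>y\<in>UNIV. H x y * v y)) + (cmod c)\<^sup>2 * Re (H x x)"
proof -
  define w where "w a = (\<Sum>b\<in>UNIV. H a b * v b)" for a
  have f: "herm_form H u = (\<Sum>a\<in>UNIV. cnj (u a) * (\<Sum>b\<in>UNIV. H a b * u b))" for u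
    by (simp add: herm_form_def sum_distrib_left mult.assoc)
  have i: "(\<Sum>b\<in>UNIV. H a b * (v b + (if b = x then c else 0))) = w a + H a x * c" for a
    by (simp add: distrib_left sum.distrib w_def if_distrib[of "\<lambda>z. _ * z"] cong: if_cong)
  have o: "(\<Sum>a\<in>UNIV. cnj (v a + (if a = x then c else 0)) * g a) = (\<Sum>a\<in>UNIV. cnj (v a) * g a) + cnj c * g x" for g
    by (simp add: distrib_right sum.distrib if_distrib[of cnj] if_distrib[of "\<lambda>z. z * _"] cong: if_cong)
  have h: "(\<Sum>a\<in>UNIV. cnj (v a) * (H a x * c)) = cnj (cnj c * w x)"
    unfolding w_def by (simp add: sum_distrib_left assms[of _ x] mult_ac)
  have "herm_form H (\<lambda>y. v y + (if y = x then c else 0))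
      = herm_form H v + cnj (cnj c * w x) + cnj c * w x + (c * cnj c) * H x x"
    unfolding f[of "\<lambda>y. v y + (if y = x then c else 0)"] i o unfolding distrib_left sum.distrib h
    by (simp add: f w_def mult_ac)
  also have "Re \<dots> = Re (herm_form H v) + 2 * Re (cnj c * w x) + (cmod c)\<^sup>2 * Re (H x x)"
    unfolding complex_norm_square[symmetric] plus_complex.sel cnj.sel times_complex.sel(1)[of "of_real _"] by simp
  finally show ?thesis unfolding w_def .
qed

text \<open>Cauchy-Schwarz for the semi-inner product of \<open>H\<close>, between \<open>v\<close>
  and the basis vector at \<open>x\<close>: the form is nonnegative on every shift of
  \<open>v\<close> along that vector, and a suitable phase turns this into a discriminant.\<close>

lemma psd_cauchy:
  assumes "psd H"
  shows "(cmod (\<Sum>y\<in>UNIV. H x y * v y))\<^sup>2 \<le> Re (herm_form H v) * Re (H x x)"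
proof -
  have herm: "\<And>x y. H y x = cnj (H x y)" and nonneg: "\<And>v. 0 \<le> Re (herm_form H v)"
    using assms unfolding psd_def by blast+
  define s where "s = (\<Sum>y\<in>UNIV. H x y * v y)"
  obtain e where e: "cmod e = 1" "e * s = of_real (cmod s)" using unit_phase_ex by blast
  have "0 \<le> Re (herm_form H v) - 2 * cmod s * r + Re (H x x) * r\<^sup>2" for r :: real
  proof -
    have "cnj (- of_real r * cnj e) * s = of_real (- r * cmod s)" using e(2) by (simp add: mult.assoc)
    then have "Re (cnj (- of_real r * cnj e) * s) = - r * cmod s" by (simp only: Re_complex_of_real)
    moreover have "(cmod (- of_real r * cnj e))\<^sup>2 = r\<^sup>2" using e(1) by (simp add: norm_mult)
    moreover have "0 \<le> Re (herm_form H v) + 2 * Re (cnj (- of_real r * cnj e) * s)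
        + (cmod (- of_real r * cnj e))\<^sup>2 * Re (H x x)"
      using nonneg[of "\<lambda>y. v y + (if y = x then - of_real r * cnj e else 0)"]
      unfolding s_def herm_form_shift[OF herm] .
    ultimately show ?thesis by (simp add: algebra_simps)
  qed
  then show ?thesis unfolding s_def[symmetric] by (rule quadratic_nonneg_discriminant)
qed

lemma psd_rank_one_sum:
  fixes H :: "'i::finite \<Rightarrow> 'i \<Rightarrow> complex"
  assumes "psd H"
  obtains vs where "H = (\<lambda>x y. \<Sum>v\<leftarrow>vs. v x * cnj (v y))"
proof -
  \<comment> \<open>The induction runs over a set containing all nonzero rows; hermiticity takes
    care of the columns.\<close>
  have "finite S \<Longrightarrow> psd H \<Longrightarrow> (\<And>x y. x \<notin> S \<Longrightarrow> H x y = 0)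
    \<Longrightarrow> \<exists>vs. H = (\<lambda>x y. \<Sum>v\<leftarrow>vs. v x * cnj (v y))" for S and H :: "'i \<Rightarrow> 'i \<Rightarrow> complex"
  proof (induction S arbitrary: H rule: finite_induct)
    case empty
    then have "H = (\<lambda>x y. \<Sum>v\<leftarrow>[]. v x * cnj (v y))" by (simp add: fun_eq_iff)
    then show ?case ..
  next
    case (insert a S)
    have herm: "H y x = cnj (H x y)" for x y using insert.prems(1) psd_def by blast
    have nn: "0 \<le> Re (herm_form H v)" for v using insert.prems(1) psd_def by blast
    define d where "d = Re (H a a)"
    have Hd: "H a a = of_real d" using herm[of a a] by (simp add: d_def complex_eq_iff)
    have row: "(\<Sum>y\<in>UNIV. H a y * (if y = z then 1 else 0)) = H a z" for z
      by (simp add: if_distrib[of "\<lambda>z. _ * z"] cong: if_cong)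
    note cauchy = psd_cauchy[OF insert.prems(1), of a, folded d_def]
    have d0: "0 \<le> d"
    proof -
      have "d = Re (herm_form H (\<lambda>y. if y = a then 1 else 0))"
        unfolding herm_form_def d_def
        by (simp add: if_distrib[of "\<lambda>z. _ * z"] if_distrib[of cnj] if_distrib[of "\<lambda>z. z * _"] cong: if_cong)
      then show ?thesis using nn by simp
    qed
    show ?case
    proof (cases "d = 0")
      case True
      \<comment> \<open>A zero diagonal entry kills its whole row, by Cauchy-Schwarz against basis
        vectors.\<close>
      have "H a z = 0" for z using cauchy[of "\<lambda>y. if y = z then 1 else 0"] True unfolding row by simp
      then have "H x y = 0" if "x \<notin> S" for x y
        using insert.prems(2)[of x y] that by (cases "x = a") auto
      then show ?thesis using insert.IH[OF insert.prems(1)] by blast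
    next
      case False
      then have dp: "0 < d" using d0 by simp
      \<comment> \<open>One Cholesky step: the Schur complement \<open>H'\<close> is supported on \<open>S\<close>.\<close>
      define v where "v x = H x a / of_real (sqrt d)" for x
      define H' where "H' x y = H x y - v x * cnj (v y)" for x y
      have vv: "v x * cnj (v y) = H x a * H a y / of_real d" for x y
        using dp herm[of y a] by (simp add: v_def flip: of_real_mult)
      have form: "herm_form H' w = herm_form H w - of_real ((cmod (\<Sum>y\<in>UNIV. H a y * w y))\<^sup>2 / d)" for w
      proof -
        have "herm_form H' w = herm_form H w - (\<Sum>x\<in>UNIV. \<Sum>y\<in>UNIV. (cnj (w x) * H x a) * (H a y * w y)) / of_real d"
          by (simp add: herm_form_def H'_def vv algebra_simps sum_subtractf sum_divide_distrib)
        also have "(\<Sum>x\<in>UNIV. \<Sum>y\<in>UNIV. (cnj (w x) * H x a) * (H a y * w y))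
           = cnj (\<Sum>y\<in>UNIV. H a y * w y) * (\<Sum>y\<in>UNIV. H a y * w y)"
          unfolding sum_product[symmetric] by (simp add: herm[of _ a] mult.commute)
        also have "\<dots> = of_real ((cmod (\<Sum>y\<in>UNIV. H a y * w y))\<^sup>2)"
          by (simp only: complex_norm_square mult.commute)
        finally show ?thesis by simp
      qed
      have "psd H'"
        unfolding psd_def
      proof (intro conjI allI)
        show "H' y x = cnj (H' x y)" for x y
          unfolding H'_def using herm[of y x] by (simp add: mult.commute)
        \<comment> \<open>By \<open>form\<close>, positivity of the Schur complement is exactly
          \<open>cauchy\<close>.\<close>
        show "0 \<le> Re (herm_form H' w)" for w
          using cauchy[of w] dp unfolding form by (simp add: field_simps)
      qed
      moreover have "H' x y = 0" if "x \<notin> S" for x y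
      proof (cases "x = a")
        case True
        then show ?thesis unfolding H'_def vv using dp by (simp add: True Hd)
      next
        case False
        then show ?thesis unfolding H'_def vv using insert.prems(2)[of x] that by simp
      qed
      ultimately obtain vs where vs: "H' = (\<lambda>x y. \<Sum>v\<leftarrow>vs. v x * cnj (v y))" using insert.IH by blast
      have "H x y = (\<Sum>v\<leftarrow>v # vs. v x * cnj (v y))" for x y
        using fun_cong[OF fun_cong[OF vs], of x y] by (simp add: H'_def algebra_simps)
      then have "H = (\<lambda>x y. \<Sum>v\<leftarrow>v # vs. v x * cnj (v y))" by (simp only: fun_eq_iff) simp
      then show ?thesis ..
    qed
  qed
  from this[of UNIV H] assms show thesis using that by auto
qed

section \<open>Existence of decompositions\<close>

lemma normalized_W: "normalized W_state"
  unfolding normalized_def sum_bool3 by (simp add: UNIV_bool W_state_def norm_divide power_divide)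

lemma scaled_normalized_ex:
  fixes v :: state3
  shows "\<exists>u. normalized u \<and> v = (\<lambda>x. of_real (sqrt (sqn v)) * u x)"
proof (cases "v = (\<lambda>_. 0)")
  case True
  \<comment> \<open>The scale factor is 0 here, so any normalized state serves as
    \<open>u\<close>.\<close>
  then have "v = (\<lambda>x. of_real (sqrt (sqn v)) * W_state x)" by (simp add: sqn_def)
  then show ?thesis using normalized_W by blast
next
  case False
  then show ?thesis using normalize_ex unfolding normalized_iff_sqn by blast
qed

text \<open>Each rank-one term is normalized and its squared norm becomes the weight; trace 1 makes
  the weights sum to 1.\<close>

lemma decomposition_ex:
  assumes "density_matrix \<rho>"
  obtains D where "decomposition \<rho> D"
proof -
  have "psd \<rho>" using assms unfolding density_matrix_def psd_def herm_form_def by blast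
  then obtain vs where vs: "\<rho> = (\<lambda>x y. \<Sum>v\<leftarrow>vs. v x * cnj (v y))" by (rule psd_rank_one_sum)
  have "\<forall>v :: state3. \<exists>u. normalized u \<and> v = (\<lambda>x. of_real (sqrt (sqn v)) * u x)"
    using scaled_normalized_ex by blast
  from choice[OF this]
  obtain u :: "state3 \<Rightarrow> state3"
    where "\<forall>v. normalized (u v) \<and> v = (\<lambda>x. of_real (sqrt (sqn v)) * u v x)" ..
  then have u: "normalized (u v)" "v = (\<lambda>x. of_real (sqrt (sqn v)) * u v x)" for v by blast+
  have proj: "of_real (sqn v) * projector (u v) x y = v x * cnj (v y)" for v x y
  proof -
    note u2 = fun_cong[OF u(2)[of v]]
    have "v x * cnj (v y) = of_real (sqrt (sqn v)) * u v x * cnj (of_real (sqrt (sqn v)) * u v y)"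
      by (rule arg_cong2[where f="\<lambda>a b. a * cnj b", OF u2 u2])
    also have "\<dots> = of_real (sqrt (sqn v) * sqrt (sqn v)) * (u v x * cnj (u v y))"
      by (simp only: of_real_mult complex_cnj_mult complex_cnj_complex_of_real mult_ac)
    finally show ?thesis by (simp add: projector_def sqn_nonneg)
  qed
  have tr: "(\<Sum>x\<in>UNIV. \<Sum>v\<leftarrow>vs. v x * cnj (v x)) = of_real (\<Sum>v\<leftarrow>vs. sqn v)" for vs :: "state3 list"
    by (induction vs) (simp_all add: sum.distrib sqn_def complex_norm_square[symmetric])
  have "(\<Sum>x\<in>UNIV. \<rho> x x) = 1" using assms unfolding density_matrix_def by blast
  then have "complex_of_real (\<Sum>v\<leftarrow>vs. sqn v) = 1" by (simp only: vs tr)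
  then have total: "(\<Sum>v\<leftarrow>vs. sqn v) = 1" by (simp only: of_real_eq_1_iff)
  have "decomposition \<rho> (map (\<lambda>v. (sqn v, u v)) vs)"
    unfolding decomposition_def
  proof (intro conjI)
    show "\<forall>(p, \<psi>)\<in>set (map (\<lambda>v. (sqn v, u v)) vs). 0 \<le> p \<and> normalized \<psi>"
      by (auto simp: u(1) sqn_nonneg)
    show "(\<Sum>(p, \<psi>)\<leftarrow>map (\<lambda>v. (sqn v, u v)) vs. p) = 1"
      using total by (simp add: o_def)
    show "\<rho> = (\<lambda>x y. \<Sum>(p, \<psi>)\<leftarrow>map (\<lambda>v. (sqn v, u v)) vs. complex_of_real p * projector \<psi> x y)"
      by (simp add: o_def proj vs)
  qed
  then show thesis by (rule that)
qed

section \<open>Rigidity of decompositions of a pure projector\<close>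

lemma decomposition_member:
  assumes "decomposition \<rho> D" "(p, \<psi>) \<in> set D"
  shows "0 \<le> p" "normalized \<psi>"
  using assms by (auto simp: decomposition_def)

lemma decomposition_expectation:
  assumes "decomposition \<rho> D"
  shows "herm_form \<rho> u = of_real (\<Sum>(p, \<psi>)\<leftarrow>D. p * (cmod (braket u \<psi>))\<^sup>2)"
proof -
  have pr: "(\<Sum>x\<in>UNIV. \<Sum>y\<in>UNIV. cnj (u x) * (of_real p * projector \<psi> x y) * u y)
      = of_real (p * (cmod (braket u \<psi>))\<^sup>2)" for p \<psi>
  proof -
    have "of_real (p * (cmod (braket u \<psi>))\<^sup>2) = of_real p * (braket u \<psi> * cnj (braket u \<psi>))"
      by (simp add: complex_norm_square[symmetric])
    also have "braket u \<psi> * cnj (braket u \<psi>) = (\<Sum>x\<in>UNIV. \<Sum>y\<in>UNIV. (cnj (u x) * \<psi> x) * (cnj (\<psi> y) * u y))"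
      unfolding sum_product[symmetric] by (simp add: braket_def mult.commute)
    finally show ?thesis by (simp add: projector_def sum_distrib_left mult_ac)
  qed
  have "herm_form (\<lambda>x y. \<Sum>(p,\<psi>)\<leftarrow>D. complex_of_real p * projector \<psi> x y) u
      = of_real (\<Sum>(p, \<psi>)\<leftarrow>D. p * (cmod (braket u \<psi>))\<^sup>2)"
  proof (induction D)
    case (Cons q D)
    obtain p \<psi> where q: "q = (p, \<psi>)" by (cases q)
    show ?case using Cons pr[of p \<psi>] unfolding q
      by (simp add: herm_form_def distrib_left distrib_right sum.distrib)
  qed (simp add: herm_form_def)
  then show ?thesis using assms by (simp add: decomposition_def)
qed

lemma braket_self: "braket u u = of_real (sqn u)"
proof -
  have "cnj (u x) * u x = of_real ((cmod (u x))\<^sup>2)" for x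
    by (simp only: complex_norm_square mult.commute)
  then show ?thesis by (simp only: braket_def sqn_def of_real_sum)
qed

text \<open>The projector is tested on \<open>u\<close>, the part of \<open>\<psi>\<close>
  orthogonal to \<open>\<omega>\<close>. Its expectation there is 0 and is also a sum of nonnegative
  terms, so the positive weight \<open>p\<close> forces \<open>\<psi>\<close> to be orthogonal to
  \<open>u\<close>, and hence \<open>u = 0\<close>.\<close>

lemma pure_decomposition_member:
  assumes D: "decomposition (projector \<omega>) D" and \<omega>: "normalized \<omega>" and mem: "(p, \<psi>) \<in> set D" "p \<noteq> 0"
  shows "\<exists>c. cmod c = 1 \<and> \<psi> = (\<lambda>x. c * \<omega> x)"
proof -
  define c where "c = braket \<omega> \<psi>"
  define u where "u = (\<lambda>x. \<psi> x - c * \<omega> x)"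
  note pos = decomposition_member[OF D]
  have "braket u \<omega> = cnj (braket \<omega> \<psi>) - cnj c * braket \<omega> \<omega>"
    by (simp add: braket_def u_def algebra_simps sum_subtractf sum_distrib_left)
  also have "\<dots> = 0" using \<omega> by (simp add: c_def braket_self normalized_iff_sqn)
  finally have u\<omega>: "braket u \<omega> = 0" .
  have single: "decomposition (projector \<omega>) [(1, \<omega>)]"
    using \<omega> by (simp add: decomposition_def)
  have "complex_of_real (\<Sum>(p, \<psi>)\<leftarrow>D. p * (cmod (braket u \<psi>))\<^sup>2) = of_real 0"
    using decomposition_expectation[OF D, of u] decomposition_expectation[OF single, of u] u\<omega> by simp
  then have "(\<Sum>(p, \<psi>)\<leftarrow>D. p * (cmod (braket u \<psi>))\<^sup>2) = 0" by (simp only: of_real_eq_iff)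
  then have "\<forall>x\<in>set (map (\<lambda>(p, \<psi>). p * (cmod (braket u \<psi>))\<^sup>2) D). x = 0"
    by (subst (asm) sum_list_nonneg_eq_0_iff) (use pos in auto)
  then have "braket u \<psi> = 0" using mem by force
  moreover have "braket u u = braket u \<psi> - c * braket u \<omega>"
    by (simp add: braket_def u_def algebra_simps sum_subtractf sum.distrib sum_distrib_left)
  ultimately have "sqn u = 0" using u\<omega> by (simp add: braket_self)
  then have \<psi>: "\<psi> = (\<lambda>x. c * \<omega> x)" by (simp add: sqn_eq_0_iff u_def fun_eq_iff)
  then have "sqn \<psi> = (cmod c)\<^sup>2 * sqn \<omega>" by (simp add: sqn_scale)
  then have "(cmod c)\<^sup>2 = 1" using pos[OF mem(1)] \<omega> by (simp add: normalized_iff_sqn)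
  then have "cmod c = 1" by (simp add: power2_eq_1_iff) (use norm_ge_zero[of c] in linarith)
  then show ?thesis using \<psi> by blast
qed

lemma EG_pure_phase:
  assumes "cmod c = 1"
  shows "EG_pure (\<lambda>x. c * \<psi> x) = EG_pure \<psi>"
proof -
  have "tri (\<lambda>x. c * \<psi> x) a b d = c * tri \<psi> a b d" for a b d
    by (simp add: tri_def sum_distrib_left mult_ac)
  then show ?thesis using assms by (simp add: EG_pure_def G_pure_eq_Sup_tri norm_mult)
qed

section \<open>The W state\<close>

text \<open>In angles b = (cos B, sin B) and c = (cos G, sin G), \<open>C\<close> and
  \<open>S\<close> are the cosine and sine of B + G, and \<open>b0 * c0\<close> is half of C + cos(B
  - G). Cauchy-Schwarz eliminates \<open>a\<close>, leaving a quadratic in \<open>C\<close> that is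
  maximal at C = 1/3.\<close>

lemma W_overlap_real:
  fixes a0 a1 b0 b1 c0 c1 :: real
  assumes "a0\<^sup>2 + a1\<^sup>2 = 1" "b0\<^sup>2 + b1\<^sup>2 = 1" "c0\<^sup>2 + c1\<^sup>2 = 1"
    and nn: "0 \<le> b0" "0 \<le> c0"
  shows "(a1 * b0 * c0 + a0 * b1 * c0 + a0 * b0 * c1)\<^sup>2 \<le> 4 / 3"
proof -
  define C S where "C = b0 * c0 - b1 * c1" and "S = b1 * c0 + b0 * c1"
  have CS: "C\<^sup>2 + S\<^sup>2 = 1"
  proof -
    have "C\<^sup>2 + S\<^sup>2 = (b0\<^sup>2 + b1\<^sup>2) * (c0\<^sup>2 + c1\<^sup>2)" by (simp add: C_def S_def power2_eq_square algebra_simps)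
    then show ?thesis using assms by simp
  qed
  have "0 \<le> (b0 - c0)\<^sup>2 + (b1 - c1)\<^sup>2" by simp
  also have "\<dots> = (b0\<^sup>2 + b1\<^sup>2) + (c0\<^sup>2 + c1\<^sup>2) - 2 * (b0 * c0 + b1 * c1)"
    by (simp add: power2_eq_square algebra_simps)
  finally have "b0 * c0 + b1 * c1 \<le> 1" using assms by simp
  then have le: "b0 * c0 \<le> (1 + C) / 2" by (simp add: C_def)
  \<comment> \<open>Lagrange's identity, the exact form of Cauchy-Schwarz for (a1, a0) and (b0 c0,
    S).\<close>
  have "(a1 * (b0 * c0) + a0 * S)\<^sup>2 + (a1 * S - a0 * (b0 * c0))\<^sup>2 = (a0\<^sup>2 + a1\<^sup>2) * ((b0 * c0)\<^sup>2 + S\<^sup>2)"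
    by (simp add: power2_eq_square algebra_simps)
  then have "(a1 * (b0 * c0) + a0 * S)\<^sup>2 \<le> (b0 * c0)\<^sup>2 + S\<^sup>2"
    using assms(1) zero_le_power2[of "a1 * S - a0 * (b0 * c0)"] by (simp only: mult_1)
  also have "\<dots> \<le> ((1 + C) / 2)\<^sup>2 + (1 - C\<^sup>2)"
    using CS le nn by (intro add_mono power_mono) auto
  also have "\<dots> = 4 / 3 - (3 * C - 1)\<^sup>2 / 12" by (simp add: power2_eq_square field_simps)
  also have "\<dots> \<le> 4 / 3" by simp
  finally show ?thesis by (simp add: S_def algebra_simps)
qed

text \<open>Only the overlap bound 4/9 is specific to W; the opposite inequality is the general
  bound \<open>EG_pure_bounds\<close>. The triangle inequality reduces the overlap to the moduli of
  the amplitudes.\<close>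

lemma EG_pure_W: "EG_pure W_state = 5 / 9"
proof -
  obtain a b c where m: "sqn a = 1" "sqn b = 1" "sqn c = 1" "G_pure W_state = cmod (tri W_state a b c)"
    by (rule G_pure_attained)
  let ?x = "cmod (a True) * cmod (b False) * cmod (c False) + cmod (a False) * cmod (b True) * cmod (c False)
      + cmod (a False) * cmod (b False) * cmod (c True)"
  have "tri W_state a b c = (a True * b False * c False + a False * b True * c False + a False * b False * c True) / of_real (sqrt 3)"
    by (simp add: tri_def UNIV_bool W_state_def add_divide_distrib)
  then have "cmod (tri W_state a b c) = cmod (a True * b False * c False + a False * b True * c False + a False * b False * c True) / sqrt 3"
    by (simp add: norm_divide)
  also have "\<dots> \<le> ?x / sqrt 3"
    by (intro divide_right_mono order_trans[OF norm_triangle_ineq] add_mono) (auto simp: norm_mult)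
  finally have "(cmod (tri W_state a b c))\<^sup>2 \<le> (?x / sqrt 3)\<^sup>2" by (intro power_mono) auto
  also have "\<dots> = ?x\<^sup>2 / 3" by (simp add: power_divide)
  also have "?x\<^sup>2 \<le> 4 / 3" by (rule W_overlap_real) (use m in \<open>auto simp: sqn_qubit\<close>)
  finally have "(G_pure W_state)\<^sup>2 \<le> 4 / 9" using m(4) by simp
  then show ?thesis using EG_pure_bounds(2)[OF normalized_W] by (simp add: EG_pure_def)
qed

section \<open>Evaluating the convex roof\<close>

lemma decomposition_average_const:
  assumes "decomposition \<rho> D" "\<And>p \<psi>. (p, \<psi>) \<in> set D \<Longrightarrow> p \<noteq> 0 \<Longrightarrow> f \<psi> = k"
  shows "(\<Sum>(p, \<psi>)\<leftarrow>D. p * f \<psi>) = (k :: real)"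
proof -
  have "(\<Sum>(p, \<psi>)\<leftarrow>D. p * f \<psi>) = (\<Sum>(p, \<psi>)\<leftarrow>D. k * p)"
    using assms(2) by (intro arg_cong[where f=sum_list] map_cong refl) force
  also have "\<dots> = k * (\<Sum>(p, \<psi>)\<leftarrow>D. p)" by (simp add: case_prod_unfold sum_list_const_mult)
  finally show ?thesis using assms(1) by (simp add: decomposition_def)
qed

lemma EG_le:
  assumes "density_matrix \<rho>"
  shows "EG \<rho> \<le> 5 / 9"
proof -
  obtain D where D: "decomposition \<rho> D" using assms by (rule decomposition_ex)
  have "EG \<rho> \<le> (\<Sum>(p,\<psi>)\<leftarrow>D. p * EG_pure \<psi>)"
    unfolding EG_def
  proof (rule cInf_lower)
    show "bdd_below {(\<Sum>(p,\<psi>)\<leftarrow>D. p * EG_pure \<psi>) | D. decomposition \<rho> D}"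
      by (rule bdd_belowI[of _ 0]) (auto intro!: sum_list_nonneg mult_nonneg_nonneg EG_pure_bounds(1) intro: decomposition_member)
  qed (use D in blast)
  also have "\<dots> \<le> (\<Sum>(p,\<psi>)\<leftarrow>D. p * (5 / 9))"
  proof (intro sum_list_mono)
    fix x assume "x \<in> set D"
    then show "(case x of (p, \<psi>) \<Rightarrow> p * EG_pure \<psi>) \<le> (case x of (p, \<psi>) \<Rightarrow> p * (5 / 9))"
      using decomposition_member[OF D, of "fst x" "snd x"]
      by (simp only: case_prod_unfold prod.collapse mult_left_mono EG_pure_bounds(2))
  qed
  also have "\<dots> = 5 / 9" by (rule decomposition_average_const[OF D]) simp
  finally show ?thesis .
qed

theorem theorem2:
  fixes \<rho> :: mat3
  assumes "density_matrix \<rho>"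
  shows "EG \<rho> \<le> EG (projector W_state) \<and> EG (projector W_state) = 5 / 9"
proof -
  \<comment> \<open>Entries of nonzero weight are phase multiples of W and so share its value;
    entries of weight 0 do not affect the average.\<close>
  have avg: "(\<Sum>(p,\<psi>)\<leftarrow>D. p * EG_pure \<psi>) = 5 / 9" if D: "decomposition (projector W_state) D" for D
    by (rule decomposition_average_const[OF D])
      (use pure_decomposition_member[OF D normalized_W] EG_pure_phase EG_pure_W in metis)
  have "decomposition (projector W_state) [(1, W_state)]"
    using normalized_W by (simp add: decomposition_def)
  then have "{(\<Sum>(p,\<psi>)\<leftarrow>D. p * EG_pure \<psi>) | D. decomposition (projector W_state) D} = {5 / 9}"
    using avg by (auto simp: EG_pure_W intro!: exI[of _ "[(1, W_state)]"])
  then have "EG (projector W_state) = 5 / 9" by (simp add: EG_def)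
  then show ?thesis using EG_le[OF assms] by simp
qed

end
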